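(* For all $\lambda,\mu>0$, the problem $$\frac{\partial}{\partial t}F(z,t)=\xi-\mu\frac{N}{z}(1-z)\,p(0,t)+\left[\frac{N}{z}(1-z)(\mu-\lambda z)-\xi\right]F(z,t)+(1-z)(\mu+\lambda z)\frac{\partial}{\partial z}F(z,t),$$ with $F(z,0)=1$, $F(1,t)=1$, $F(0,t)=p(0,t)$, which is satisfied by the probability generating function $F(z,t)=E[z^{\mathcal N(t)}]=\sum_{k=0}^N z^kp(k,t)$, admits the following solution for $z\in(0,1]$ and $t\ge0$: $$\begin{aligned}F(z,t)={}&\frac{e^{-\xi t}\left[\lambda(1-z)+(z\lambda+\mu)e^{t(\lambda+\mu)}\right]^N\left[\mu(z-1)+(z\lambda+\mu)e^{t(\lambda+\mu)}\right]^N}{z^Ne^{2Nt(\lambda+\mu)}(\lambda+\mu)^{2N}}\\ &+\frac{\xi}{z^N(\lambda+\mu)^{2N}}\int_0^te^{-\xi(t-y)}\left[\lambda(1-z)e^{-(t-y)(\lambda+\mu)}+(z\lambda+\mu)\right]^N\left[\mu(z-1)e^{-(t-y)(\lambda+\mu)}+(z\lambda+\mu)\right]^Ndy\\ &+\frac{N\mu(z-1)}{z^N(\lambda+\mu)^{2N-1}}\int_0^tp(0,y)e^{-(\lambda+\mu+\xi)(t-y)}\left[\lambda(1-z)e^{-(t-y)(\lambda+\mu)}+(z\lambda+\mu)\right]^N\left[\mu(z-1)e^{-(t-y)(\lambda+\mu)}+(z\lambda+\mu)\right]^{N-1}dy.\end{aligned}$$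
   Context: Let $N,d$ be positive integers, $D=\{1,\dots,d\}$, $\lambda,\mu,\xi>0$, and let $\mathbf C=(c_{l,j})_{l,j\in D}$ be an irreducible stochastic matrix. The process $\mathbf X_t=(\mathcal N(t),J(t))$, $t\ge 0$, is the continuous-time Markov chain on $\{0,1,\dots,N\}\times D$ (first coordinate: level; second coordinate: phase) started at $(0,l_0)$ for some $l_0\in D$, with the following transition rates: from $(0,l)$ to $(1,j)$ at rate $c_{l,j}\lambda N$ for $l,j\in D$; from $(k,j)$ to $(k+1,j)$ at rate $\lambda(N-k)$ for $1\le k\le N-1$; from $(k,j)$ to $(k-1,j)$ at rate $\mu(N+k)$ for $1\le k\le N$; and, in addition, from $(k,j)$ to $(0,j)$ at rate $\xi$ for $1\le k\le N$ (catastrophe; for $k=1$ the total rate from $(1,j)$ to $(0,j)$ is $\mu(N+1)+\xi$). No other transitions occur. Write $p(k,j,t)=P\{(\mathcal N(t),J(t))=(k,j)\mid(\mathcal N(0),J(0))=(0,l_0)\}$ and $p(k,t)=\sum_{j\in D}p(k,j,t)$. The value $F(0,t)$ is understood as the limit as $z\to0^+$. *)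

theory Defs
  imports "HOL-Probability.Probability"
begin

definition stochastic_matrix :: "'i set \<Rightarrow> ('i \<Rightarrow> 'i \<Rightarrow> real) \<Rightarrow> bool" where
  "stochastic_matrix D c \<longleftrightarrow>
     (\<forall>l\<in>D. \<forall>j\<in>D. 0 \<le> c l j) \<and> (\<forall>l\<in>D. (\<Sum>j\<in>D. c l j) = 1)"

text \<open>Irreducibility of a nonnegative matrix: the digraph of its positive entries is strongly
  connected.\<close>

definition irreducible_matrix :: "'i set \<Rightarrow> ('i \<Rightarrow> 'i \<Rightarrow> real) \<Rightarrow> bool" where
  "irreducible_matrix D c \<longleftrightarrow>
     (\<forall>l\<in>D. \<forall>j\<in>D. (l, j) \<in> {(a, b). a \<in> D \<and> b \<in> D \<and> 0 < c a b}\<^sup>+)"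

text \<open>A time-homogeneous continuous-time Markov chain on a finite state space \<open>S\<close>, with
  jump rates \<open>r x y\<close> for \<open>x \<noteq> y\<close>. The values \<open>r x x\<close> are irrelevant: since \<open>S\<close> is
  finite, the off-diagonal rates determine the diagonal of the generator. The past of time \<open>s\<close> is
  represented by finitely many earlier times \<open>T\<close> and the states \<open>f u\<close> occupied at \<open>u \<in> T\<close>.
  Conditional probabilities are constrained only when the conditioning event has positive
  probability (otherwise \<open>cond_prob\<close> is 0 by convention). No path regularity is assumed.\<close>

definition markov_chain_with_rates ::
  "'w measure \<Rightarrow> 's set \<Rightarrow> ('s \<Rightarrow> 's \<Rightarrow> real) \<Rightarrow> (real \<Rightarrow> 'w \<Rightarrow> 's) \<Rightarrow> bool" where
  "markov_chain_with_rates M S r X \<longleftrightarrow>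
     prob_space M \<and> finite S \<and>
     (\<forall>t\<ge>0. X t \<in> measurable M (count_space S)) \<and>
     (\<forall>s t T f x y. 0 \<le> s \<and> s \<le> t \<and> finite T \<and> T \<subseteq> {0..<s} \<and>
        \<P>(\<omega> in M. X s \<omega> = x \<and> (\<forall>u\<in>T. X u \<omega> = f u)) > 0 \<longrightarrow>
        \<P>(\<omega> in M. X t \<omega> = y \<bar> X s \<omega> = x \<and> (\<forall>u\<in>T. X u \<omega> = f u)) =
        \<P>(\<omega> in M. X t \<omega> = y \<bar> X s \<omega> = x)) \<and>
     (\<forall>s s' h x y. 0 \<le> s \<and> 0 \<le> s' \<and> 0 \<le> h \<and>
        \<P>(\<omega> in M. X s \<omega> = x) > 0 \<and> \<P>(\<omega> in M. X s' \<omega> = x) > 0 \<longrightarrow>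
        \<P>(\<omega> in M. X (s + h) \<omega> = y \<bar> X s \<omega> = x) =
        \<P>(\<omega> in M. X (s' + h) \<omega> = y \<bar> X s' \<omega> = x)) \<and>
     (\<forall>s\<ge>0. \<forall>x\<in>S. \<forall>y\<in>S. x \<noteq> y \<and> \<P>(\<omega> in M. X s \<omega> = x) > 0 \<longrightarrow>
        ((\<lambda>h. \<P>(\<omega> in M. X (s + h) \<omega> = y \<bar> X s \<omega> = x) / h) \<longlongrightarrow> r x y) (at_right 0))"

text \<open>States are pairs (level, phase). The summands are added so that at level 1 the downward jump
  and the catastrophe together give the total rate \<open>\<mu> (N + 1) + \<xi>\<close>.\<close>

definition jump_rate ::
  "nat \<Rightarrow> (nat \<Rightarrow> nat \<Rightarrow> real) \<Rightarrow> real \<Rightarrow> real \<Rightarrow> real \<Rightarrow> nat \<times> nat \<Rightarrow> nat \<times> nat \<Rightarrow> real" where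
  "jump_rate N c lam \<mu> \<xi> x y = (case x of (k, l) \<Rightarrow> case y of (k', j) \<Rightarrow>
      (if k = 0 \<and> k' = 1 then c l j * lam * real N else 0)
    + (if 1 \<le> k \<and> k < N \<and> k' = k + 1 \<and> j = l then lam * (real N - real k) else 0)
    + (if 1 \<le> k \<and> k \<le> N \<and> k = k' + 1 \<and> j = l then \<mu> * (real N + real k) else 0)
    + (if 1 \<le> k \<and> k \<le> N \<and> k' = 0 \<and> j = l then \<xi> else 0))"

definition state_prob ::
  "'w measure \<Rightarrow> (real \<Rightarrow> 'w \<Rightarrow> nat \<times> nat) \<Rightarrow> nat \<Rightarrow> nat \<Rightarrow> nat \<Rightarrow> real \<Rightarrow> real" where
  "state_prob M X l0 k j t = \<P>(\<omega> in M. X t \<omega> = (k, j) \<bar> X 0 \<omega> = (0, l0))"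

definition level_prob ::
  "'w measure \<Rightarrow> (real \<Rightarrow> 'w \<Rightarrow> nat \<times> nat) \<Rightarrow> nat \<Rightarrow> nat \<Rightarrow> nat \<Rightarrow> real \<Rightarrow> real" where
  "level_prob M X d l0 k t = (\<Sum>j\<in>{1..d}. state_prob M X l0 k j t)"

definition level_pgf ::
  "'w measure \<Rightarrow> (real \<Rightarrow> 'w \<Rightarrow> nat \<times> nat) \<Rightarrow> real \<Rightarrow> real \<Rightarrow> real" where
  "level_pgf M X z t = (\<integral>\<omega>. z ^ fst (X t \<omega>) \<partial>M)"

text \<open>The initial-boundary value problem on \<open>0 < z \<le> 1\<close>, \<open>t \<ge> 0\<close>, where \<open>q t\<close> stands for
  \<open>p(0,t)\<close>. Derivatives are one-sided at \<open>t = 0\<close> and \<open>z = 1\<close>; the condition at \<open>z = 0\<close> is a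
  limit from the right.\<close>

definition solves_problem ::
  "nat \<Rightarrow> real \<Rightarrow> real \<Rightarrow> real \<Rightarrow> (real \<Rightarrow> real) \<Rightarrow> (real \<Rightarrow> real \<Rightarrow> real) \<Rightarrow> bool" where
  "solves_problem N lam \<mu> \<xi> q F \<longleftrightarrow>
     (\<forall>z\<in>{0<..1}. \<forall>t\<ge>0. \<exists>Ft Fz.
        ((\<lambda>s. F z s) has_real_derivative Ft) (at t within {0..}) \<and>
        ((\<lambda>x. F x t) has_real_derivative Fz) (at z within {0<..1}) \<and>
        Ft = \<xi> - \<mu> * (real N / z) * (1 - z) * q t
             + ((real N / z) * (1 - z) * (\<mu> - lam * z) - \<xi>) * F z t
             + (1 - z) * (\<mu> + lam * z) * Fz) \<and>
     (\<forall>z\<in>{0<..1}. F z 0 = 1) \<and>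
     (\<forall>t\<ge>0. F 1 t = 1) \<and>
     (\<forall>t\<ge>0. ((\<lambda>z. F z t) \<longlongrightarrow> q t) (at_right 0))"

definition explicit_solution ::
  "nat \<Rightarrow> real \<Rightarrow> real \<Rightarrow> real \<Rightarrow> (real \<Rightarrow> real) \<Rightarrow> real \<Rightarrow> real \<Rightarrow> real" where
  "explicit_solution N lam \<mu> \<xi> q z t =
     exp (- \<xi> * t)
       * (lam * (1 - z) + (z * lam + \<mu>) * exp (t * (lam + \<mu>))) ^ N
       * (\<mu> * (z - 1) + (z * lam + \<mu>) * exp (t * (lam + \<mu>))) ^ N
       / (z ^ N * exp (2 * real N * t * (lam + \<mu>)) * (lam + \<mu>) ^ (2 * N))
   + \<xi> / (z ^ N * (lam + \<mu>) ^ (2 * N))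
       * integral {0..t} (\<lambda>y. exp (- \<xi> * (t - y))
           * (lam * (1 - z) * exp (- (t - y) * (lam + \<mu>)) + (z * lam + \<mu>)) ^ N
           * (\<mu> * (z - 1) * exp (- (t - y) * (lam + \<mu>)) + (z * lam + \<mu>)) ^ N)
   + real N * \<mu> * (z - 1) / (z ^ N * (lam + \<mu>) ^ (2 * N - 1))
       * integral {0..t} (\<lambda>y. q y * exp (- (lam + \<mu> + \<xi>) * (t - y))
           * (lam * (1 - z) * exp (- (t - y) * (lam + \<mu>)) + (z * lam + \<mu>)) ^ N
           * (\<mu> * (z - 1) * exp (- (t - y) * (lam + \<mu>)) + (z * lam + \<mu>)) ^ (N - 1))"

end

theory Submission
  imports Defs
begin

text \<open>The rates give \<open>d/dt E[f(level)] = E[(L f)(level)]\<close> for the generator \<open>L\<close> of the level process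
  (the phase drops out because the rows of \<open>c\<close> sum to 1), and \<open>f k = z ^ k\<close> yields the differential
  equation. Its characteristic through \<open>(z, t)\<close> is \<open>w y = B y / A y\<close>, where
  \<open>A y = \<lambda> (1 - z) exp (-(t - y) (\<lambda> + \<mu>)) + (z \<lambda> + \<mu>)\<close> and
  \<open>B y = \<mu> (z - 1) exp (-(t - y) (\<lambda> + \<mu>)) + (z \<lambda> + \<mu>)\<close>. After multiplication by the integrating
  factor \<open>exp (-\<xi> (t - y)) (A y * B y) ^ N\<close>, the generating function along it is the expectation
  of \<open>exp (-\<xi> (t - y)) A y ^ (N - k) * B y ^ (N + k)\<close> at level \<open>k\<close>, free of division.
  Since \<open>A' = \<lambda> (A - B)\<close> and \<open>B' = -\<mu> (A - B)\<close>, the up and down jumps cancel against the time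
  derivative of the weights; only the catastrophe term and a boundary term with \<open>p(0, y)\<close> remain,
  and integrating over \<open>[0, t]\<close> gives the formula.\<close>

section \<open>Finite chains: the forward equation from the jump rates\<close>

text \<open>Homogeneity makes the conditional probabilities independent of the starting time, but
  only at times when \<open>x\<close> has positive probability. Completing them to one kernel
  \<open>P\<close> on all of \<open>S\<close> gives the law of total probability without case
  distinctions.\<close>

lemma markov_chain_transition:
  assumes mc: "markov_chain_with_rates M S r X"
  obtains P where
    "\<And>s h y. 0 \<le> s \<Longrightarrow> 0 \<le> h \<Longrightarrow> y \<in> S \<Longrightarrow>
       \<P>(\<omega> in M. X (s + h) \<omega> = y) = (\<Sum>x\<in>S. \<P>(\<omega> in M. X s \<omega> = x) * P h x y)"
    and "\<And>h x. 0 \<le> h \<Longrightarrow> x \<in> S \<Longrightarrow> (\<Sum>y\<in>S. P h x y) = (1::real)"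
    and "\<And>x y. x \<in> S \<Longrightarrow> y \<in> S \<Longrightarrow> x \<noteq> y \<Longrightarrow> ((\<lambda>h. P h x y / h) \<longlongrightarrow> r x y) (at_right 0)"
proof -
  interpret prob_space M using mc by (simp add: markov_chain_with_rates_def)
  have fin: "finite S" using mc by (simp add: markov_chain_with_rates_def)
  have meas: "X t \<in> measurable M (count_space S)" if "0 \<le> t" for t
    using mc that by (simp add: markov_chain_with_rates_def)
  have inS: "X t \<omega> \<in> S" if "0 \<le> t" "\<omega> \<in> space M" for t \<omega>
    using measurable_space[OF meas[OF that(1)] that(2)] by simp
  have ev: "{\<omega> \<in> space M. X t \<omega> = x} \<in> events" if "0 \<le> t" for t x
  proof (cases "x \<in> S")
    case True
    have "X t -` {x} \<inter> space M \<in> events"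
      using meas[OF that] True by (intro measurable_sets) auto
    moreover have "X t -` {x} \<inter> space M = {\<omega> \<in> space M. X t \<omega> = x}" by auto
    ultimately show ?thesis by simp
  next
    case False
    then have "{\<omega> \<in> space M. X t \<omega> = x} = {}" using inS[OF that] by auto
    then show ?thesis by (simp only: sets.empty_sets)
  qed
  have ev2: "{\<omega> \<in> space M. X t \<omega> = x \<and> X s \<omega> = y} \<in> events" if "0 \<le> t" "0 \<le> s" for t s x y
  proof -
    have "{\<omega> \<in> space M. X t \<omega> = x \<and> X s \<omega> = y}
      = {\<omega> \<in> space M. X t \<omega> = x} \<inter> {\<omega> \<in> space M. X s \<omega> = y}" by auto
    then show ?thesis using ev that by auto
  qed
  define \<pi> where "\<pi> s x = \<P>(\<omega> in M. X s \<omega> = x)" for s x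
  define K where "K s h x y = \<P>(\<omega> in M. X (s + h) \<omega> = y \<bar> X s \<omega> = x)" for s h x y
  \<comment> \<open>A reference time at which \<open>x\<close> is occupied, if there is one; by
    homogeneity any such time yields the same kernel.\<close>
  define \<sigma> where "\<sigma> x = (SOME s. 0 \<le> s \<and> 0 < \<pi> s x)" for x
  \<comment> \<open>For states that are never occupied the kernel is arbitrary; a linear one keeps the rates.\<close>
  define P where "P h x y = (if \<exists>s\<ge>0. 0 < \<pi> s x then K (\<sigma> x) h x y
     else if x = y then 1 - h * (\<Sum>z\<in>S-{x}. r x z) else h * r x y)" for h x y
  have \<sigma>: "0 \<le> \<sigma> x \<and> 0 < \<pi> (\<sigma> x) x" if "0 \<le> s" "0 < \<pi> s x" for s x
    unfolding \<sigma>_def by (rule someI[of _ s]) (use that in auto)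
  have hom: "P h x y = K s h x y" if "0 \<le> s" "0 \<le> h" "0 < \<pi> s x" for s h x y
  proof -
    have "K (\<sigma> x) h x y = K s h x y"
      using mc \<sigma>[OF that(1,3)] that
      unfolding markov_chain_with_rates_def K_def \<pi>_def by blast
    then show ?thesis using that by (auto simp: P_def)
  qed
  have tot: "\<pi> (s + h) y = (\<Sum>x\<in>S. \<pi> s x * P h x y)" if "0 \<le> s" "0 \<le> h" for s h y
  proof -
    have "\<pi> (s + h) y
        = measure M (\<Union>x\<in>S. {\<omega> \<in> space M. X (s + h) \<omega> = y \<and> X s \<omega> = x})"
      unfolding \<pi>_def using inS[OF that(1)] by (intro arg_cong[where f = "measure M"]) auto
    also have "\<dots> = (\<Sum>x\<in>S. \<P>(\<omega> in M. X (s + h) \<omega> = y \<and> X s \<omega> = x))"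
      using fin ev2 that
      by (intro finite_measure_finite_Union) (auto simp: disjoint_family_on_def)
    also have "\<dots> = (\<Sum>x\<in>S. \<pi> s x * P h x y)"
    proof (rule sum.cong[OF refl])
      fix x
      show "\<P>(\<omega> in M. X (s + h) \<omega> = y \<and> X s \<omega> = x) = \<pi> s x * P h x y"
      proof (cases "0 < \<pi> s x")
        case True
        then show ?thesis using hom[OF that True, of y]
          by (simp add: K_def cond_prob_def \<pi>_def)
      next
        \<comment> \<open>If \<open>x\<close> has probability 0 at time \<open>s\<close>, the joint
          event is null as well, so whatever value \<open>P h x y\<close> has there is multiplied by
          0.\<close>
        case False
        then have "\<pi> s x = 0" by (metis \<pi>_def measure_nonneg less_eq_real_def)
        moreover have "\<P>(\<omega> in M. X (s + h) \<omega> = y \<and> X s \<omega> = x) \<le> \<pi> s x"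
          unfolding \<pi>_def using ev that by (intro finite_measure_mono) auto
        ultimately show ?thesis
          by (metis measure_nonneg mult_zero_left order_antisym)
      qed
    qed
    finally show ?thesis .
  qed
  have row: "(\<Sum>y\<in>S. P h x y) = 1" if "0 \<le> h" "x \<in> S" for h x
  proof (cases "\<exists>s\<ge>0. 0 < \<pi> s x")
    case True
    then obtain s where s: "0 \<le> s" "0 < \<pi> s x" by blast
    have "\<pi> s x = measure M (\<Union>y\<in>S. {\<omega> \<in> space M. X (s + h) \<omega> = y \<and> X s \<omega> = x})"
      unfolding \<pi>_def using inS[of "s + h"] s that
      by (intro arg_cong[where f = "measure M"]) auto
    also have "\<dots> = (\<Sum>y\<in>S. \<P>(\<omega> in M. X (s + h) \<omega> = y \<and> X s \<omega> = x))"
      using fin ev2 that s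
      by (intro finite_measure_finite_Union) (auto simp: disjoint_family_on_def)
    also have "\<dots> = (\<Sum>y\<in>S. P h x y * \<pi> s x)"
      using s hom[OF s(1) that(1) s(2)]
      by (intro sum.cong[OF refl]) (simp add: K_def cond_prob_def \<pi>_def)
    also have "\<dots> = (\<Sum>y\<in>S. P h x y) * \<pi> s x" by (simp add: sum_distrib_right)
    finally show ?thesis using s by simp
  next
    case False
    have "(\<Sum>y\<in>S. P h x y) = P h x x + (\<Sum>y\<in>S - {x}. P h x y)"
      using fin that by (simp add: sum.remove)
    also have "(\<Sum>y\<in>S - {x}. P h x y) = (\<Sum>y\<in>S - {x}. h * r x y)"
      using False by (intro sum.cong[OF refl]) (auto simp: P_def)
    also have "P h x x = 1 - h * (\<Sum>y\<in>S - {x}. r x y)" using False by (auto simp: P_def)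
    finally show ?thesis by (simp add: sum_distrib_left)
  qed
  have lim: "((\<lambda>h. P h x y / h) \<longlongrightarrow> r x y) (at_right 0)" if "x \<in> S" "y \<in> S" "x \<noteq> y" for x y
  proof (cases "\<exists>s\<ge>0. 0 < \<pi> s x")
    case True
    then have "0 \<le> \<sigma> x \<and> 0 < \<pi> (\<sigma> x) x" using \<sigma> by blast
    moreover have "\<forall>s\<ge>0. \<forall>x\<in>S. \<forall>y\<in>S. x \<noteq> y \<and> 0 < \<pi> s x \<longrightarrow>
        ((\<lambda>h. K s h x y / h) \<longlongrightarrow> r x y) (at_right 0)"
      using mc unfolding markov_chain_with_rates_def K_def \<pi>_def by (elim conjE)
    ultimately have "((\<lambda>h. K (\<sigma> x) h x y / h) \<longlongrightarrow> r x y) (at_right 0)"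
      using that by simp
    then show ?thesis using True by (simp add: P_def)
  next
    case False
    have "((\<lambda>h. r x y) \<longlongrightarrow> r x y) (at_right (0::real))" by simp
    moreover have "\<forall>\<^sub>F h in at_right (0::real). r x y = P h x y / h"
      using False that by (auto simp: P_def eventually_at_filter)
    ultimately show ?thesis by (rule Lim_transform_eventually)
  qed
  show thesis
    by (rule that[of P]) (use tot row lim in \<open>auto simp: \<pi>_def\<close>)
qed

text \<open>The rates control only forward increments, so the right derivative is immediate. For the
  left derivative the increment is read from \<open>s - h\<close> forward to \<open>s\<close>; its
  weights are the state probabilities at \<open>s - h\<close>, so left continuity of these must come
  first.\<close>

lemma markov_chain_derivative:
  fixes g :: "'s \<Rightarrow> real"
  assumes mc: "markov_chain_with_rates M S r X" and t: "0 \<le> t"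
  shows "((\<lambda>t. \<Sum>x\<in>S. \<P>(\<omega> in M. X t \<omega> = x) * g x) has_real_derivative
           (\<Sum>x\<in>S. \<P>(\<omega> in M. X t \<omega> = x) * (\<Sum>y\<in>S. r x y * (g y - g x)))) (at t within {0..})"
proof -
  interpret prob_space M using mc by (simp add: markov_chain_with_rates_def)
  have fin: "finite S" using mc by (simp add: markov_chain_with_rates_def)
  define \<pi> where "\<pi> s x = \<P>(\<omega> in M. X s \<omega> = x)" for s x
  have \<pi>01: "0 \<le> \<pi> s x" "\<pi> s x \<le> 1" for s x by (auto simp: \<pi>_def)
  obtain P where tot: "\<And>s h y. 0 \<le> s \<Longrightarrow> 0 \<le> h \<Longrightarrow> y \<in> S \<Longrightarrow>
       \<pi> (s + h) y = (\<Sum>x\<in>S. \<pi> s x * P h x y)"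
    and row: "\<And>h x. 0 \<le> h \<Longrightarrow> x \<in> S \<Longrightarrow> (\<Sum>y\<in>S. P h x y) = (1::real)"
    and lim: "\<And>x y. x \<in> S \<Longrightarrow> y \<in> S \<Longrightarrow> x \<noteq> y \<Longrightarrow> ((\<lambda>h. P h x y / h) \<longlongrightarrow> r x y) (at_right 0)"
    unfolding \<pi>_def
  proof (rule markov_chain_transition[OF mc], goal_cases)
    case (1 P)
    show ?case by (rule 1(1)[OF 1(2-4)])
  qed
  define u where "u g s = (\<Sum>x\<in>S. \<pi> s x * g x)" for g :: "'s \<Rightarrow> real" and s
  define D where "D g h x = (\<Sum>y\<in>S. P h x y * (g y - g x))" for g :: "'s \<Rightarrow> real" and h x
  define L where "L g x = (\<Sum>y\<in>S. r x y * (g y - g x))" for g :: "'s \<Rightarrow> real" and x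
  \<comment> \<open>Because the rows of \<open>P\<close> sum to 1, the increment of the mean of
    \<open>g\<close> is the mean of the one-step drift \<open>D g h\<close>.\<close>
  have incr: "u g (s + h) - u g s = (\<Sum>x\<in>S. \<pi> s x * D g h x)" if "0 \<le> s" "0 \<le> h" for g s h
  proof -
    have "u g (s + h) = (\<Sum>y\<in>S. \<Sum>x\<in>S. \<pi> s x * P h x y * g y)"
      using that by (simp add: u_def tot sum_distrib_right)
    also have "\<dots> = (\<Sum>x\<in>S. \<pi> s x * (\<Sum>y\<in>S. P h x y * g y))"
      by (subst sum.swap) (simp add: sum_distrib_left mult.assoc)
    also have "\<dots> = (\<Sum>x\<in>S. \<pi> s x * (D g h x + g x))"
    proof (intro sum.cong[OF refl])
      fix x assume "x \<in> S"
      then have "D g h x = (\<Sum>y\<in>S. P h x y * g y) - g x"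
        using row[OF that(2)]
        by (simp add: D_def right_diff_distrib sum_subtractf flip: sum_distrib_right)
      then show "\<pi> s x * (\<Sum>y\<in>S. P h x y * g y) = \<pi> s x * (D g h x + g x)" by simp
    qed
    finally show ?thesis by (simp add: u_def distrib_left sum.distrib)
  qed
  have D_lim: "((\<lambda>h. D g h x / h) \<longlongrightarrow> L g x) (at_right 0)" if "x \<in> S" for g x
  proof -
    have "((\<lambda>h. P h x y / h * (g y - g x)) \<longlongrightarrow> r x y * (g y - g x)) (at_right 0)"
      if "y \<in> S" for y
    \<comment> \<open>On the diagonal \<open>g y - g x\<close> vanishes, so the limits of the
      off-diagonal entries suffice.\<close>
    proof (cases "x = y")
      case False
      then show ?thesis using lim[OF \<open>x \<in> S\<close> that] by (intro tendsto_mult tendsto_const)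
    qed simp
    then have "((\<lambda>h. \<Sum>y\<in>S. P h x y / h * (g y - g x)) \<longlongrightarrow> L g x) (at_right 0)"
      unfolding L_def by (intro tendsto_sum)
    then show ?thesis by (simp add: D_def sum_divide_distrib)
  qed
  have D_lim0: "((\<lambda>h. D g h x) \<longlongrightarrow> 0) (at_right 0)" if "x \<in> S" for g x
  proof -
    have "((\<lambda>h. D g h x / h * h) \<longlongrightarrow> L g x * 0) (at_right 0)"
      by (intro tendsto_mult D_lim that tendsto_ident_at)
    moreover have "\<forall>\<^sub>F h in at_right (0::real). D g h x / h * h = D g h x"
      by (auto simp: eventually_at_filter)
    ultimately show ?thesis using Lim_transform_eventually by fastforce
  qed
  have right: "((\<lambda>h. (u g (s + h) - u g s) / h) \<longlongrightarrow> (\<Sum>x\<in>S. \<pi> s x * L g x)) (at_right 0)"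
    if "0 \<le> s" for g s
  proof -
    have "((\<lambda>h. \<Sum>x\<in>S. \<pi> s x * (D g h x / h)) \<longlongrightarrow> (\<Sum>x\<in>S. \<pi> s x * L g x)) (at_right 0)"
      by (intro tendsto_intros D_lim)
    moreover have "\<forall>\<^sub>F h in at_right (0::real).
        (\<Sum>x\<in>S. \<pi> s x * (D g h x / h)) = (u g (s + h) - u g s) / h"
      using incr[OF that] by (auto simp: eventually_at_filter sum_divide_distrib)
    ultimately show ?thesis by (rule Lim_transform_eventually)
  qed
  have small: "\<forall>\<^sub>F h in at_right (0::real). 0 < h \<and> h < s" if "0 < s" for s
    using that by (auto simp: eventually_at_right)
  \<comment> \<open>The weights at \<open>s - h\<close> are bounded by 1, so the increment is at
    most the sum of the drifts \<open>\<bar>D g h x\<bar>\<close>, each of which tends to 0.\<close>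
  have left0: "((\<lambda>h. u g (s - h)) \<longlongrightarrow> u g s) (at_right 0)" if "0 < s" for g s
  proof -
    have "((\<lambda>h. u g s - u g (s - h)) \<longlongrightarrow> 0) (at_right 0)"
    proof (rule Lim_null_comparison)
      show "((\<lambda>h. \<Sum>x\<in>S. \<bar>D g h x\<bar>) \<longlongrightarrow> 0) (at_right 0)"
        by (intro tendsto_null_sum tendsto_rabs_zero D_lim0)
      show "\<forall>\<^sub>F h in at_right 0. norm (u g s - u g (s - h)) \<le> (\<Sum>x\<in>S. \<bar>D g h x\<bar>)"
        using small[OF that]
      proof eventually_elim
        case (elim h)
        then have "u g s - u g (s - h) = (\<Sum>x\<in>S. \<pi> (s - h) x * D g h x)"
          using incr[of "s - h" h g] by simp
        also have "norm \<dots> \<le> (\<Sum>x\<in>S. \<bar>D g h x\<bar>)"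
          using \<pi>01 by (intro order_trans[OF norm_sum] sum_mono)
            (auto simp: abs_mult intro: mult_left_le_one_le)
        finally show ?case .
      qed
    qed
    from tendsto_diff[OF tendsto_const[of "u g s"] this] show ?thesis by simp
  qed
  have left: "((\<lambda>h. (u g s - u g (s - h)) / h) \<longlongrightarrow> (\<Sum>x\<in>S. \<pi> s x * L g x)) (at_right 0)"
    if "0 < s" for g s
  proof -
    \<comment> \<open>Left continuity of the mean, applied to the indicator of \<open>x\<close>, is
      left continuity of the probability of \<open>x\<close>.\<close>
    have "((\<lambda>h. \<pi> (s - h) x) \<longlongrightarrow> \<pi> s x) (at_right 0)" if "x \<in> S" for x
      using left0[OF \<open>0 < s\<close>, of "\<lambda>y. if y = x then 1 else 0"] fin that
      by (simp add: u_def if_distrib cong: if_cong)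
    then have "((\<lambda>h. \<Sum>x\<in>S. \<pi> (s - h) x * (D g h x / h)) \<longlongrightarrow> (\<Sum>x\<in>S. \<pi> s x * L g x)) (at_right 0)"
      by (intro tendsto_sum tendsto_mult D_lim)
    moreover have "\<forall>\<^sub>F h in at_right (0::real).
        (\<Sum>x\<in>S. \<pi> (s - h) x * (D g h x / h)) = (u g s - u g (s - h)) / h"
      using small[OF that]
    proof eventually_elim
      case (elim h)
      then show ?case using incr[of "s - h" h g] by (simp add: sum_divide_distrib)
    qed
    ultimately show ?thesis by (rule Lim_transform_eventually)
  qed
  have R: "((\<lambda>y. (u g y - u g t) / (y - t)) \<longlongrightarrow> (\<Sum>x\<in>S. \<pi> t x * L g x)) (at_right t)"
    using right[OF t, of g] by (subst filterlim_at_right_to_0) (simp add: add.commute)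
  have "((\<lambda>y. (u g y - u g t) / (y - t)) \<longlongrightarrow> (\<Sum>x\<in>S. \<pi> t x * L g x)) (at t within {0..})"
  \<comment> \<open>At time 0 the filter sees only the right side; at later times it is two-sided
    and both one-sided limits are combined.\<close>
  proof (cases "t = 0")
    case True
    have "at (0::real) within {0..} = at_right 0"
      by (rule at_within_nhd[of _ UNIV]) auto
    then show ?thesis using R True by simp
  next
    case False
    with t have t': "0 < t" by simp
    have "at_left t = filtermap (\<lambda>h. t - h) (at_right 0)"
      using at_left_minus[of t] at_right_to_0[of "-t"] by (simp add: filtermap_filtermap)
    then have "((\<lambda>y. (u g y - u g t) / (y - t)) \<longlongrightarrow> (\<Sum>x\<in>S. \<pi> t x * L g x)) (at_left t)"
      using left[OF t', of g]
      by (simp add: filterlim_filtermap minus_divide_left)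
    moreover have "at t within {0..} = at t"
      using t' by (intro at_within_interior) simp
    ultimately show ?thesis using R by (simp add: filterlim_at_split)
  qed
  then show ?thesis by (simp add: has_field_derivative_iff u_def L_def \<pi>_def)
qed

lemma markov_chain_expectation:
  fixes g :: "'s \<Rightarrow> real"
  assumes mc: "markov_chain_with_rates M S r X" and t: "0 \<le> t"
  shows "(\<integral>\<omega>. g (X t \<omega>) \<partial>M) = (\<Sum>x\<in>S. \<P>(\<omega> in M. X t \<omega> = x) * g x)"
proof -
  interpret prob_space M using mc by (simp add: markov_chain_with_rates_def)
  have fin: "finite S" using mc by (simp add: markov_chain_with_rates_def)
  have meas: "X t \<in> measurable M (count_space S)"
    using mc t by (simp add: markov_chain_with_rates_def)
  define A where "A x = X t -` {x} \<inter> space M" for x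
  have A: "A x \<in> events" if "x \<in> S" for x
    unfolding A_def using meas that by (intro measurable_sets) auto
  have "(\<integral>\<omega>. g (X t \<omega>) \<partial>M) = (\<integral>\<omega>. (\<Sum>x\<in>S. g x * indicator (A x) \<omega>) \<partial>M)"
  proof (rule Bochner_Integration.integral_cong[OF refl])
    fix \<omega> assume \<omega>: "\<omega> \<in> space M"
    have "(\<Sum>x\<in>S. g x * indicator (A x) \<omega>) = (\<Sum>x\<in>S. if x = X t \<omega> then g x else 0)"
      using \<omega> by (intro sum.cong[OF refl]) (auto simp: A_def)
    then show "g (X t \<omega>) = (\<Sum>x\<in>S. g x * indicator (A x) \<omega>)"
      using fin measurable_space[OF meas \<omega>] by simp
  qed
  also have "\<dots> = (\<Sum>x\<in>S. g x * measure M (A x))"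
    using A by (subst Bochner_Integration.integral_sum)
      (auto intro!: sum.cong simp: A_def less_top[symmetric])
  finally show ?thesis by (simp add: A_def vimage_def Int_def mult.commute conj_commute)
qed

section \<open>The generator of the level process\<close>

text \<open>At \<open>k = N\<close> the factor \<open>N - k\<close> removes the value
  \<open>f (Suc N)\<close> outside the level range; at \<open>k = 0\<close> the catastrophe term is
  0 by itself.\<close>

definition level_generator ::
  "nat \<Rightarrow> real \<Rightarrow> real \<Rightarrow> real \<Rightarrow> (nat \<Rightarrow> real) \<Rightarrow> nat \<Rightarrow> real" where
  "level_generator N lam \<mu> \<xi> f k =
     lam * (real N - real k) * (f (Suc k) - f k)
     + (if k = 0 then 0 else \<mu> * (real N + real k) * (f (k - 1) - f k))
     + \<xi> * (f 0 - f k)"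

text \<open>On functions of the level alone the phase disappears: at level 0 the entries
  \<open>c l j\<close> sum to 1 over the target phases, and all other jumps keep the phase.\<close>

lemma sum_jump_rate:
  assumes "stochastic_matrix {1..d} c" and "1 \<le> N" and "k \<le> N" and "l \<in> {1..d}"
  shows "(\<Sum>y\<in>{0..N} \<times> {1..d}. jump_rate N c lam \<mu> \<xi> (k, l) y * (f (fst y) - f k))
    = level_generator N lam \<mu> \<xi> f k"
proof (cases "k = 0")
  case True
  have "(\<Sum>y\<in>{0..N} \<times> {1..d}. jump_rate N c lam \<mu> \<xi> (k, l) y * (f (fst y) - f k))
    = (\<Sum>k'\<in>{0..N}. \<Sum>j\<in>{1..d}. if k' = 1 then c l j * (lam * real N * (f 1 - f 0)) else 0)"
    unfolding sum.cartesian_product using True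
    by (intro sum.cong[OF refl]) (auto simp: jump_rate_def)
  also have "\<dots> = (\<Sum>j\<in>{1..d}. c l j * (lam * real N * (f 1 - f 0)))"
    using assms(2) by (subst sum.swap) simp
  also have "\<dots> = lam * real N * (f 1 - f 0)"
    using assms(1,4) by (simp add: stochastic_matrix_def flip: sum_distrib_right)
  finally show ?thesis using True by (simp add: level_generator_def)
next
  case False
  \<comment> \<open>For \<open>k = 1\<close> the targets \<open>k - 1\<close> and 0 coincide and
    both summands count, as in \<open>jump_rate\<close>; for \<open>k = N\<close> the target
    \<open>Suc k\<close> is outside the range of summation.\<close>
  have "(\<Sum>y\<in>{0..N} \<times> {1..d}. jump_rate N c lam \<mu> \<xi> (k, l) y * (f (fst y) - f k))
    = (\<Sum>k'\<in>{0..N}. \<Sum>j\<in>{1..d}. if j = l then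
         (if k' = Suc k then lam * (real N - real k) * (f (Suc k) - f k) else 0)
       + (if k' = k - 1 then \<mu> * (real N + real k) * (f (k - 1) - f k) else 0)
       + (if k' = 0 then \<xi> * (f 0 - f k) else 0) else 0)"
    unfolding sum.cartesian_product using False assms(3)
    by (intro sum.cong[OF refl]) (auto simp: jump_rate_def algebra_simps)
  also have "\<dots> = level_generator N lam \<mu> \<xi> f k"
    using assms False by (auto simp: sum.distrib level_generator_def)
  finally show ?thesis .
qed

text \<open>\<open>real k * z ^ (k - 1)\<close> is the derivative of \<open>z ^ k\<close>, so jump
  rates affine in \<open>k\<close> become a first-order operator in \<open>z\<close>. The correction
  at \<open>k = 0\<close> removes the downward rate \<open>\<mu> * N\<close> that the uniform
  formula would assign to level 0; it produces the term with \<open>p(0,t)\<close>.\<close>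

lemma level_generator_power:
  assumes "z \<noteq> 0"
  shows "level_generator N lam \<mu> \<xi> (\<lambda>k. z ^ k) k
    = \<xi> - (if k = 0 then \<mu> * (real N / z) * (1 - z) else 0)
      + ((real N / z) * (1 - z) * (\<mu> - lam * z) - \<xi>) * z ^ k
      + (1 - z) * (\<mu> + lam * z) * (real k * z ^ (k - 1))"
proof -
  \<comment> \<open>Writing \<open>N = n * z\<close> turns the claim into a polynomial identity
    without division.\<close>
  define n where "n = real N / z"
  have n: "real N / z = n" "real N = n * z" using assms by (simp_all add: n_def)
  show ?thesis unfolding level_generator_def n(1) unfolding n(2)
    by (cases k) (simp_all add: algebra_simps)
qed

text \<open>The second summand is the time derivative of
  \<open>e * (A ^ (N - k) * B ^ (N + k))\<close> when \<open>e' = \<xi> * e\<close>,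
  \<open>A' = lam * (A - B)\<close> and \<open>B' = - \<mu> * (A - B)\<close>. Up jumps trade a
  factor \<open>A\<close> for \<open>B\<close> and cancel \<open>A'\<close>; down jumps do the
  reverse and cancel \<open>B'\<close>, except at level 0, where there is no down jump. The
  catastrophe loss cancels \<open>e'\<close>.\<close>

lemma level_generator_weight:
  fixes A B e :: real
  assumes "k \<le> N" and "1 \<le> N"
  shows "level_generator N lam \<mu> \<xi> (\<lambda>k. e * (A ^ (N - k) * B ^ (N + k))) k
      + (\<xi> * e * (A ^ (N - k) * B ^ (N + k))
         + e * (real (N - k) * A ^ (N - k - 1) * (lam * (A - B)) * B ^ (N + k)
                - real (N + k) * B ^ (N + k - 1) * (\<mu> * (A - B)) * A ^ (N - k)))
    = \<xi> * e * (A * B) ^ N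
      - (if k = 0 then real N * \<mu> * (A - B) * e * A ^ N * B ^ (N - 1) else 0)"
proof -
  have up: "lam * (real N - real k) * (e * (A ^ (N - Suc k) * B ^ (N + Suc k))
        - e * (A ^ (N - k) * B ^ (N + k)))
      + e * (real (N - k) * A ^ (N - k - 1) * (lam * (A - B)) * B ^ (N + k)) = 0"
  proof (cases "k = N")
    case False
    \<comment> \<open>With \<open>N = Suc (k + m)\<close> all truncated subtractions in the
      exponents become explicit.\<close>
    then obtain m where "N = Suc (k + m)" using assms less_imp_Suc_add[of k N] by auto
    then have "N - k = Suc m" "N - Suc k = m" "N - k - 1 = m" "N + Suc k = Suc (N + k)"
      "real N - real k = real (N - k)" by auto
    then show ?thesis by (simp only: power_Suc) (simp add: algebra_simps)
  qed simp
  have down: "(if k = 0 then 0 else \<mu> * (real N + real k)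
        * (e * (A ^ (N - (k - 1)) * B ^ (N + (k - 1))) - e * (A ^ (N - k) * B ^ (N + k))))
      - e * (real (N + k) * B ^ (N + k - 1) * (\<mu> * (A - B)) * A ^ (N - k))
      = - (if k = 0 then real N * \<mu> * (A - B) * e * A ^ N * B ^ (N - 1) else 0)"
  proof (cases k)
    case (Suc i)
    then have "N - (k - 1) = Suc (N - k)" "N + (k - 1) = N + i" "N + k - 1 = N + i"
      "N + k = Suc (N + i)" "real N + real k = real (N + k)" "k \<noteq> 0"
      using assms by auto
    then show ?thesis by (simp only: power_Suc if_False) (simp add: algebra_simps)
  qed simp
  have "\<xi> * (e * (A ^ (N - 0) * B ^ (N + 0)) - e * (A ^ (N - k) * B ^ (N + k)))
      = \<xi> * e * (A * B) ^ N - \<xi> * e * (A ^ (N - k) * B ^ (N + k))"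
    by (simp add: power_mult_distrib right_diff_distrib)
  with up down show ?thesis
    unfolding level_generator_def right_diff_distrib[of e] by linarith
qed

section \<open>The generating function: differential equation and explicit formula\<close>

text \<open>The forward equation is stated in weak form, for every test function of the level:
  powers of \<open>z\<close> give the differential equation, indicators the differentiability of
  each \<open>p k\<close>, and the weights along a characteristic the formula.\<close>

locale level_distribution =
  fixes N :: nat and lam \<mu> \<xi> :: real and p :: "nat \<Rightarrow> real \<Rightarrow> real"
  assumes N: "1 \<le> N" and pos: "0 < lam" "0 < \<mu>"
    and init: "k \<le> N \<Longrightarrow> p k 0 = (if k = 0 then 1 else 0)"
    and sum_p: "0 \<le> t \<Longrightarrow> (\<Sum>k=0..N. p k t) = 1"
    and forward: "0 \<le> t \<Longrightarrow> ((\<lambda>t. \<Sum>k=0..N. p k t * f k) has_real_derivative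
           (\<Sum>k=0..N. p k t * level_generator N lam \<mu> \<xi> f k)) (at t within {0..})"
begin

definition pgf :: "real \<Rightarrow> real \<Rightarrow> real" where
  "pgf z t = (\<Sum>k=0..N. z ^ k * p k t)"

lemma p_differentiable:
  assumes "0 \<le> t" "k \<le> N"
  shows "\<exists>D. (p k has_real_derivative D) (at t within {0..})"
proof -
  have "(\<lambda>t. \<Sum>j=0..N. p j t * (if j = k then 1 else 0)) = p k"
    using assms by (simp add: if_distrib cong: if_cong)
  then show ?thesis using forward[OF assms(1), of "\<lambda>j. if j = k then 1 else 0"] by auto
qed

lemma pgf_solves_problem: "solves_problem N lam \<mu> \<xi> (p 0) pgf"
  unfolding solves_problem_def
proof (intro conjI ballI allI impI)
  fix z t :: real
  assume z: "z \<in> {0<..1}" and t: "0 \<le> t"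
  let ?Fz = "\<Sum>k=0..N. real k * z ^ (k - 1) * p k t"
  have "((\<lambda>x. pgf x t) has_real_derivative ?Fz) (at z within {0<..1})"
    unfolding pgf_def by (auto intro!: derivative_eq_intros sum.cong)
  moreover have "(pgf z has_real_derivative
      (\<Sum>k=0..N. p k t * level_generator N lam \<mu> \<xi> (\<lambda>k. z ^ k) k)) (at t within {0..})"
    using forward[OF t, of "\<lambda>k. z ^ k"] by (simp add: pgf_def[abs_def] mult.commute)
  moreover have "(\<Sum>k=0..N. p k t * level_generator N lam \<mu> \<xi> (\<lambda>k. z ^ k) k)
      = \<xi> - \<mu> * (real N / z) * (1 - z) * p 0 t
        + ((real N / z) * (1 - z) * (\<mu> - lam * z) - \<xi>) * pgf z t
        + (1 - z) * (\<mu> + lam * z) * ?Fz"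
  proof -
    define a b e where "a = \<mu> * (real N / z) * (1 - z)"
      and "b = (real N / z) * (1 - z) * (\<mu> - lam * z) - \<xi>"
      and "e = (1 - z) * (\<mu> + lam * z)"
    have "(\<Sum>k=0..N. p k t * level_generator N lam \<mu> \<xi> (\<lambda>k. z ^ k) k)
      = (\<Sum>k=0..N. \<xi> * p k t - (if k = 0 then a * p 0 t else 0) + b * (z ^ k * p k t)
            + e * (real k * z ^ (k - 1) * p k t))"
      using z by (intro sum.cong[OF refl])
        (simp add: level_generator_power a_def b_def e_def algebra_simps)
    also have "\<dots> = \<xi> * (\<Sum>k=0..N. p k t) - a * p 0 t + b * pgf z t + e * ?Fz"
      by (simp add: sum.distrib sum_subtractf pgf_def flip: sum_distrib_left)
    finally show ?thesis using sum_p[OF t] by (simp add: a_def b_def e_def)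
  qed
  ultimately show "\<exists>Ft Fz. ((\<lambda>s. pgf z s) has_real_derivative Ft) (at t within {0..}) \<and>
        ((\<lambda>x. pgf x t) has_real_derivative Fz) (at z within {0<..1}) \<and>
        Ft = \<xi> - \<mu> * (real N / z) * (1 - z) * p 0 t
             + ((real N / z) * (1 - z) * (\<mu> - lam * z) - \<xi>) * pgf z t
             + (1 - z) * (\<mu> + lam * z) * Fz"
    by (intro exI conjI)
next
  fix z :: real
  have "pgf z 0 = (\<Sum>k=0..N. if k = 0 then 1 else 0)"
    unfolding pgf_def by (intro sum.cong[OF refl]) (simp add: init)
  then show "pgf z 0 = 1" by simp
next
  fix t :: real assume "0 \<le> t"
  then show "pgf 1 t = 1" by (simp add: pgf_def sum_p)
next
  fix t :: real assume "0 \<le> t"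
  \<comment> \<open>A polynomial in \<open>z\<close> is continuous at 0, and
    \<open>0 ^ 0 = 1\<close> keeps exactly the level-0 summand.\<close>
  have "((\<lambda>z. pgf z t) \<longlongrightarrow> (\<Sum>k=0..N. 0 ^ k * p k t)) (at_right 0)"
    unfolding pgf_def by (intro tendsto_intros)
  also have "(\<Sum>k=0..N. 0 ^ k * p k t) = (\<Sum>k=0..N. if k = 0 then p 0 t else 0)"
    by (intro sum.cong[OF refl]) auto
  finally show "((\<lambda>z. pgf z t) \<longlongrightarrow> p 0 t) (at_right 0)" by simp
qed

text \<open>The weights along a characteristic change with time. The test function is split into its
  value frozen at \<open>t\<close>, to which \<open>forward\<close> applies, and its
  increment.\<close>

lemma forward_moving:
  assumes t: "0 \<le> t"
    and a: "\<And>k. k \<le> N \<Longrightarrow> (a k has_real_derivative a' k) (at t within {0..})"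
  shows "((\<lambda>s. \<Sum>k=0..N. p k s * a k s) has_real_derivative
           (\<Sum>k=0..N. p k t * (level_generator N lam \<mu> \<xi> (\<lambda>k. a k t) k + a' k))) (at t within {0..})"
proof -
  \<comment> \<open>The second factor vanishes at \<open>s = t\<close>, so the unknown derivative of \<open>p k\<close> does not contribute.\<close>
  have "((\<lambda>s. p k s * (a k s - a k t)) has_real_derivative p k t * a' k) (at t within {0..})"
    if "k \<le> N" for k
    using p_differentiable[OF t that] a[OF that] by (auto intro!: derivative_eq_intros)
  then have "((\<lambda>s. \<Sum>k=0..N. p k s * (a k s - a k t)) has_real_derivative
      (\<Sum>k=0..N. p k t * a' k)) (at t within {0..})"
    by (intro DERIV_sum) auto
  from DERIV_add[OF forward[OF t, of "\<lambda>k. a k t"] this] show ?thesis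
    by (simp add: algebra_simps flip: sum.distrib)
qed

lemma pgf_eq_explicit_solution:
  assumes z: "z \<in> {0<..1}" and t: "0 \<le> t"
  shows "pgf z t = explicit_solution N lam \<mu> \<xi> (p 0) z t"
proof -
  define L where "L = lam + \<mu>"
  have L: "0 < L" using pos by (simp add: L_def)
  define E where "E y = exp (- (t - y) * L)" for y
  define e where "e y = exp (- \<xi> * (t - y))" for y
  define A where "A y = lam * (1 - z) * E y + (z * lam + \<mu>)" for y
  define B where "B y = \<mu> * (z - 1) * E y + (z * lam + \<mu>)" for y
  define a where "a k y = e y * (A y ^ (N - k) * B y ^ (N + k))" for k y
  define a' where "a' k y = \<xi> * e y * (A y ^ (N - k) * B y ^ (N + k))
         + e y * (real (N - k) * A y ^ (N - k - 1) * (lam * (A y - B y)) * B y ^ (N + k)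
                - real (N + k) * B y ^ (N + k - 1) * (\<mu> * (A y - B y)) * A y ^ (N - k))" for k y
  define H where "H y = (\<Sum>k=0..N. p k y * a k y)" for y
  \<comment> \<open>\<open>I1\<close> and \<open>I2\<close> are the integrands of the two integrals
    in \<open>explicit_solution\<close>.\<close>
  define I1 where "I1 y = e y * A y ^ N * B y ^ N" for y
  define I2 where "I2 y = p 0 y * exp (- (lam + \<mu> + \<xi>) * (t - y)) * A y ^ N * B y ^ (N - 1)" for y
  \<comment> \<open>This difference supplies the factor \<open>L * (z - 1)\<close> of the boundary
    term, and \<open>E y * e y\<close> gives the exponential with rate
    \<open>lam + \<mu> + \<xi>\<close> in \<open>I2\<close>.\<close>
  have AB: "A y - B y = L * (1 - z) * E y" for y
    by (simp add: A_def B_def L_def algebra_simps)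
  have dE: "(E has_real_derivative L * E y) (at y within {0..})" for y
    unfolding E_def by (auto intro!: derivative_eq_intros)
  have de: "(e has_real_derivative \<xi> * e y) (at y within {0..})" for y
    unfolding e_def by (auto intro!: derivative_eq_intros)
  have dA: "(A has_real_derivative lam * (A y - B y)) (at y within {0..})" for y
    unfolding AB unfolding A_def by (auto intro!: derivative_eq_intros dE)
  have dB: "(B has_real_derivative - (\<mu> * (A y - B y))) (at y within {0..})" for y
    unfolding AB unfolding B_def by (auto intro!: derivative_eq_intros dE simp: algebra_simps)
  have da: "(a k has_real_derivative a' k y) (at y within {0..})" for k y
    unfolding a_def a'_def
    by (rule derivative_eq_intros de dA dB refl)+ (simp add: algebra_simps)
  have dH: "(H has_real_derivative \<xi> * I1 y + real N * \<mu> * L * (z - 1) * I2 y) (at y within {0..})"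
    if y: "0 \<le> y" for y
  proof -
    have "(\<Sum>k=0..N. p k y * (level_generator N lam \<mu> \<xi> (\<lambda>k. a k y) k + a' k y))
      = (\<Sum>k=0..N. \<xi> * I1 y * p k y - (if k = 0 then
           p 0 y * (real N * \<mu> * (A y - B y) * e y * A y ^ N * B y ^ (N - 1)) else 0))"
    proof (intro sum.cong[OF refl])
      fix k assume "k \<in> {0..N}"
      then have "k \<le> N" by simp
      from level_generator_weight[OF this N, of lam \<mu> \<xi> "e y" "A y" "B y"]
      show "p k y * (level_generator N lam \<mu> \<xi> (\<lambda>k. a k y) k + a' k y)
      = \<xi> * I1 y * p k y - (if k = 0 then
           p 0 y * (real N * \<mu> * (A y - B y) * e y * A y ^ N * B y ^ (N - 1)) else 0)"
        unfolding a_def a'_def by (simp only:) (simp add: I1_def power_mult_distrib algebra_simps)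
    qed
    also have "\<dots> = \<xi> * I1 y
        - p 0 y * (real N * \<mu> * (A y - B y) * e y * A y ^ N * B y ^ (N - 1))"
      using sum_p[OF y] by (simp add: sum_subtractf flip: sum_distrib_left)
    also have "exp (- (lam + \<mu> + \<xi>) * (t - y)) = E y * e y"
      unfolding E_def e_def L_def by (simp add: algebra_simps flip: exp_add)
    then have "\<xi> * I1 y - p 0 y * (real N * \<mu> * (A y - B y) * e y * A y ^ N * B y ^ (N - 1))
        = \<xi> * I1 y + real N * \<mu> * L * (z - 1) * I2 y"
      unfolding AB I2_def by (simp only:) (simp add: algebra_simps)
    finally show ?thesis
      unfolding H_def[abs_def] by (rule DERIV_cong[OF forward_moving[where a = a, OF y da]])
  qed
  have int: "((\<lambda>y. \<xi> * I1 y + real N * \<mu> * L * (z - 1) * I2 y) has_integral H t - H 0) {0..t}"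
  proof (rule fundamental_theorem_of_calculus[OF t])
    fix y assume "y \<in> {0..t}"
    then have "(H has_real_derivative \<xi> * I1 y + real N * \<mu> * L * (z - 1) * I2 y) (at y within {0..t})"
      by (intro has_field_derivative_subset[OF dH]) auto
    then show "(H has_vector_derivative \<xi> * I1 y + real N * \<mu> * L * (z - 1) * I2 y) (at y within {0..t})"
      by (simp add: has_real_derivative_iff_has_vector_derivative)
  qed
  \<comment> \<open>Continuity of \<open>p 0\<close> makes \<open>I1\<close> and \<open>I2\<close>
    separately integrable, so that the integral of the sum may be split.\<close>
  have p0: "continuous_on {0..t} (p 0)"
  proof (rule continuous_on_subset)
    show "continuous_on {0..} (p 0)"
      unfolding continuous_on_eq_continuous_within
      using p_differentiable[of _ 0] DERIV_continuous by fastforce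
  qed auto
  have c1: "I1 integrable_on {0..t}" and c2: "I2 integrable_on {0..t}"
    unfolding I1_def I2_def A_def B_def E_def e_def
    by (intro integrable_continuous_real continuous_intros p0)+
  have "H t - H 0 = \<xi> * integral {0..t} I1 + real N * \<mu> * L * (z - 1) * integral {0..t} I2"
    by (rule has_integral_unique[OF int])
      (intro has_integral_add has_integral_mult_right integrable_integral c1 c2)
  \<comment> \<open>At \<open>y = t\<close> the characteristic reaches \<open>z\<close>:
    \<open>A t = L\<close> and \<open>B t = z * L\<close>, so level \<open>k\<close> carries the
    weight \<open>L ^ (2 * N) * z ^ (N + k)\<close>.\<close>
  moreover have "H t = z ^ N * L ^ (2 * N) * pgf z t"
  proof -
    have "A t = L" "B t = z * L" "e t = 1"
      by (simp_all add: A_def B_def E_def e_def L_def algebra_simps)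
    then have "H t = (\<Sum>k=0..N. p k t * (L ^ (N - k) * (z * L) ^ (N + k)))"
      by (simp add: H_def a_def)
    also have "\<dots> = (\<Sum>k=0..N. z ^ N * L ^ (2 * N) * (z ^ k * p k t))"
    proof (intro sum.cong[OF refl])
      fix k assume "k \<in> {0..N}"
      then have "L ^ (2 * N) = L ^ (N - k) * L ^ (N + k)"
        by (simp add: mult_2 flip: power_add)
      then show "p k t * (L ^ (N - k) * (z * L) ^ (N + k)) = z ^ N * L ^ (2 * N) * (z ^ k * p k t)"
        by (simp add: power_mult_distrib power_add)
    qed
    finally show ?thesis by (simp add: pgf_def sum_distrib_left)
  qed
  \<comment> \<open>The initial distribution is concentrated on level 0, so one weight
    survives.\<close>
  moreover have "H 0 = e 0 * (A 0 ^ N * B 0 ^ N)"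
  proof -
    have "H 0 = (\<Sum>k=0..N. if k = 0 then a 0 0 else 0)"
      unfolding H_def by (intro sum.cong[OF refl]) (simp add: init)
    then show ?thesis by (simp add: a_def)
  qed
  ultimately have "pgf z t = (e 0 * (A 0 ^ N * B 0 ^ N) + \<xi> * integral {0..t} I1
      + real N * \<mu> * L * (z - 1) * integral {0..t} I2) / (z ^ N * L ^ (2 * N))"
    using z L by (simp add: field_simps)
  also have "\<dots> = e 0 * (A 0 ^ N * B 0 ^ N) / (z ^ N * L ^ (2 * N))
      + \<xi> / (z ^ N * L ^ (2 * N)) * integral {0..t} I1
      + real N * \<mu> * (z - 1) / (z ^ N * L ^ (2 * N - 1)) * integral {0..t} I2"
  proof -
    \<comment> \<open>The \<open>L\<close> coming from \<open>A y - B y\<close> cancels one power;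
      \<open>N \<ge> 1\<close> makes the exponent \<open>2 * N - 1\<close> genuine.\<close>
    have "L ^ (2 * N) = L * L ^ (2 * N - 1)" using N by (simp flip: power_Suc)
    then show ?thesis using L by (simp add: add_divide_distrib)
  qed
  also have "e 0 * (A 0 ^ N * B 0 ^ N) / (z ^ N * L ^ (2 * N))
    = exp (- \<xi> * t)
       * (lam * (1 - z) + (z * lam + \<mu>) * exp (t * L)) ^ N
       * (\<mu> * (z - 1) + (z * lam + \<mu>) * exp (t * L)) ^ N
       / (z ^ N * exp (2 * real N * t * L) * L ^ (2 * N))"
  proof -
    \<comment> \<open>Since \<open>E 0 = 1 / x\<close>, extracting \<open>1 / x\<close> from each of
      the \<open>2 * N\<close> factors \<open>A 0\<close> and \<open>B 0\<close> produces
      \<open>exp (2 * N * t * L)\<close> in the denominator.\<close>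
    define x where "x = exp (t * L)"
    have x: "x > 0" "E 0 = 1 / x" by (simp_all add: x_def E_def exp_minus field_simps)
    have A: "A 0 = (lam * (1 - z) + (z * lam + \<mu>) * x) / x"
      and B: "B 0 = (\<mu> * (z - 1) + (z * lam + \<mu>) * x) / x"
      using x by (simp_all add: A_def B_def add_divide_distrib)
    have "exp (2 * real N * t * L) = x ^ N * x ^ N"
      unfolding x_def by (simp add: algebra_simps flip: exp_of_nat_mult exp_add)
    then show ?thesis unfolding A B x_def[symmetric]
      by (simp add: e_def power_divide mult_ac)
  qed
  finally show ?thesis
    unfolding explicit_solution_def I1_def I2_def A_def B_def E_def e_def L_def .
qed

end

section \<open>Transfer to the chain with phases\<close>

text \<open>All derivatives are taken within \<open>{0..}\<close> or \<open>{0<..1}\<close> and the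
  limit at 0 is one-sided, so the problem sees only values on this domain, where the three
  candidates agree.\<close>

lemma solves_problem_cong:
  assumes F: "solves_problem N lam \<mu> \<xi> q F"
    and eq: "\<And>z t. z \<in> {0<..1} \<Longrightarrow> 0 \<le> t \<Longrightarrow> F z t = G z t"
  shows "solves_problem N lam \<mu> \<xi> q G"
  unfolding solves_problem_def
proof (intro conjI ballI allI impI)
  fix z t :: real
  assume z: "z \<in> {0<..1}" and t: "0 \<le> t"
  obtain Ft Fz where Ft: "((\<lambda>s. F z s) has_real_derivative Ft) (at t within {0..})"
    and Fz: "((\<lambda>x. F x t) has_real_derivative Fz) (at z within {0<..1})"
    and pde: "Ft = \<xi> - \<mu> * (real N / z) * (1 - z) * q t
             + ((real N / z) * (1 - z) * (\<mu> - lam * z) - \<xi>) * F z t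
             + (1 - z) * (\<mu> + lam * z) * Fz"
    using F z t unfolding solves_problem_def by blast
  have "((\<lambda>s. G z s) has_real_derivative Ft) (at t within {0..})"
    using z t eq by (intro has_field_derivative_transform_within[OF Ft, of 1]) auto
  moreover have "((\<lambda>x. G x t) has_real_derivative Fz) (at z within {0<..1})"
    using z t eq by (intro has_field_derivative_transform_within[OF Fz, of 1]) auto
  ultimately show "\<exists>Ft Fz. ((\<lambda>s. G z s) has_real_derivative Ft) (at t within {0..}) \<and>
        ((\<lambda>x. G x t) has_real_derivative Fz) (at z within {0<..1}) \<and>
        Ft = \<xi> - \<mu> * (real N / z) * (1 - z) * q t
             + ((real N / z) * (1 - z) * (\<mu> - lam * z) - \<xi>) * G z t
             + (1 - z) * (\<mu> + lam * z) * Fz"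
    using pde eq[OF z t] by auto
next
  fix z :: real assume "z \<in> {0<..1}"
  then show "G z 0 = 1" using F eq[of z 0] by (simp add: solves_problem_def)
next
  fix t :: real assume "0 \<le> t"
  then show "G 1 t = 1" using F eq[of 1 t] by (simp add: solves_problem_def)
next
  fix t :: real assume t: "0 \<le> t"
  then have "((\<lambda>z. F z t) \<longlongrightarrow> q t) (at_right 0)" using F by (simp add: solves_problem_def)
  moreover have "\<forall>\<^sub>F z in at_right 0. F z t = G z t"
    unfolding eventually_at_right_field using eq t by (intro exI[of _ 1]) auto
  ultimately show "((\<lambda>z. G z t) \<longlongrightarrow> q t) (at_right 0)"
    by (rule Lim_transform_eventually)
qed

theorem proposition3p2:
  fixes N d l0 :: nat
    and lam \<mu> \<xi> :: real
    and c :: "nat \<Rightarrow> nat \<Rightarrow> real"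
    and M :: "'w measure"
    and X :: "real \<Rightarrow> 'w \<Rightarrow> nat \<times> nat"
  assumes "1 \<le> N" and "1 \<le> d"
    and "0 < lam" and "0 < \<mu>" and "0 < \<xi>"
    and "stochastic_matrix {1..d} c" and "irreducible_matrix {1..d} c"
    and "markov_chain_with_rates M ({0..N} \<times> {1..d}) (jump_rate N c lam \<mu> \<xi>) X"
    and "l0 \<in> {1..d}" and "AE \<omega> in M. X 0 \<omega> = (0, l0)"
  shows "(\<forall>z. \<forall>t\<ge>0. level_pgf M X z t = (\<Sum>k=0..N. z ^ k * level_prob M X d l0 k t))
    \<and> solves_problem N lam \<mu> \<xi> (level_prob M X d l0 0) (level_pgf M X)
    \<and> solves_problem N lam \<mu> \<xi> (level_prob M X d l0 0)
         (explicit_solution N lam \<mu> \<xi> (level_prob M X d l0 0))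
    \<and> (\<forall>z\<in>{0<..1}. \<forall>t\<ge>0.
         level_pgf M X z t = explicit_solution N lam \<mu> \<xi> (level_prob M X d l0 0) z t)"
proof -
  let ?S = "{0..N} \<times> {1..d}"
  note mc = assms(8)
  interpret prob_space M using mc by (simp add: markov_chain_with_rates_def)
  define p where "p = level_prob M X d l0"
  have ev: "{\<omega> \<in> space M. X s \<omega> = x} \<in> events" if "0 \<le> s" for s x
  proof -
    have meas: "X s \<in> measurable M (count_space ?S)"
      using mc that by (simp add: markov_chain_with_rates_def)
    \<comment> \<open>Intersecting with the state space covers states \<open>x\<close> outside it as
      well, for which the event is empty.\<close>
    have "X s -` ({x} \<inter> ?S) \<inter> space M \<in> events"
      using meas by (intro measurable_sets) auto
    moreover have "X s -` ({x} \<inter> ?S) \<inter> space M = {\<omega> \<in> space M. X s \<omega> = x}"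
      using measurable_space[OF meas] by (simp add: set_eq_iff) metis
    ultimately show ?thesis by simp
  qed
  \<comment> \<open>The start state is almost sure, so conditioning on it changes no
    probability.\<close>
  have start: "state_prob M X l0 k j t = \<P>(\<omega> in M. X t \<omega> = (k, j))" if "0 \<le> t" for k j t
  proof -
    have "\<P>(\<omega> in M. X 0 \<omega> = (0, l0)) = 1"
      using assms(10) ev by (subst prob_Collect_eq_1) auto
    moreover have "\<P>(\<omega> in M. X t \<omega> = (k, j) \<and> X 0 \<omega> = (0, l0)) = \<P>(\<omega> in M. X t \<omega> = (k, j))"
    proof (rule measure_eq_AE)
      show "AE \<omega> in M. (\<omega> \<in> {\<omega> \<in> space M. X t \<omega> = (k, j) \<and> X 0 \<omega> = (0, l0)})
          = (\<omega> \<in> {\<omega> \<in> space M. X t \<omega> = (k, j)})"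
        using assms(10) by eventually_elim auto
      have "{\<omega> \<in> space M. X t \<omega> = (k, j) \<and> X 0 \<omega> = (0, l0)}
        = {\<omega> \<in> space M. X t \<omega> = (k, j)} \<inter> {\<omega> \<in> space M. X 0 \<omega> = (0, l0)}" by auto
      then show "{\<omega> \<in> space M. X t \<omega> = (k, j) \<and> X 0 \<omega> = (0, l0)} \<in> events"
        using ev[OF that] ev[of 0] by auto
    qed (rule ev[OF that])
    ultimately show ?thesis by (simp add: state_prob_def cond_prob_def)
  qed
  have levels: "(\<Sum>x\<in>?S. \<P>(\<omega> in M. X t \<omega> = x) * f (fst x)) = (\<Sum>k=0..N. p k t * f k)"
    if "0 \<le> t" for f t
    using that start
    by (simp add: p_def level_prob_def sum_distrib_right sum.cartesian_product split_beta)
  have pgf: "level_pgf M X z t = (\<Sum>k=0..N. z ^ k * p k t)" if "0 \<le> t" for z t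
    using markov_chain_expectation[OF mc that, of "\<lambda>x. z ^ fst x"] levels[OF that, of "\<lambda>k. z ^ k"]
    by (simp add: level_pgf_def mult.commute)
  interpret level_distribution N lam \<mu> \<xi> p
  proof
    fix t :: real assume t: "0 \<le> t"
    show "(\<Sum>k=0..N. p k t) = 1"
      \<comment> \<open>At \<open>z = 1\<close> the expectation is the total mass.\<close>
      using pgf[OF t, of 1] by (simp add: level_pgf_def prob_space)
    fix f :: "nat \<Rightarrow> real"
    have "(\<Sum>x\<in>?S. \<P>(\<omega> in M. X t \<omega> = x)
          * (\<Sum>y\<in>?S. jump_rate N c lam \<mu> \<xi> x y * (f (fst y) - f (fst x))))
        = (\<Sum>x\<in>?S. \<P>(\<omega> in M. X t \<omega> = x) * level_generator N lam \<mu> \<xi> f (fst x))"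
      by (intro sum.cong[OF refl]) (auto simp only: mem_Times_iff sum_jump_rate[OF assms(6,1)]
        split_paired_all fst_conv snd_conv atLeastAtMost_iff)
    also have "\<dots> = (\<Sum>k=0..N. p k t * level_generator N lam \<mu> \<xi> f k)"
      by (rule levels[OF t])
    finally have "((\<lambda>t. \<Sum>x\<in>?S. \<P>(\<omega> in M. X t \<omega> = x) * f (fst x)) has_real_derivative
        (\<Sum>k=0..N. p k t * level_generator N lam \<mu> \<xi> f k)) (at t within {0..})"
      using markov_chain_derivative[OF mc t, of "\<lambda>x. f (fst x)"] by simp
    then show "((\<lambda>t. \<Sum>k=0..N. p k t * f k) has_real_derivative
        (\<Sum>k=0..N. p k t * level_generator N lam \<mu> \<xi> f k)) (at t within {0..})"
      by (rule has_field_derivative_transform_within[of _ _ _ _ 1]) (use t levels in auto)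
  next
    fix k assume "k \<le> N"
    have "\<P>(\<omega> in M. X 0 \<omega> = (k, j)) = (if k = 0 \<and> j = l0 then 1 else 0)" for j
    proof -
      \<comment> \<open>Up to a null set the event is the whole space or empty.\<close>
      have "\<P>(\<omega> in M. X 0 \<omega> = (k, j)) = measure M {\<omega> \<in> space M. k = 0 \<and> j = l0}"
      proof (rule measure_eq_AE)
        show "AE \<omega> in M. (\<omega> \<in> {\<omega> \<in> space M. X 0 \<omega> = (k, j)})
            = (\<omega> \<in> {\<omega> \<in> space M. k = 0 \<and> j = l0})"
          using assms(10) by eventually_elim auto
      qed (auto intro: ev)
      then show ?thesis by (auto simp: prob_space)
    qed
    then show "p k 0 = (if k = 0 then 1 else 0)"
      using assms(9) by (simp add: p_def level_prob_def start)
  qed (use assms in auto)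
  have eq: "level_pgf M X z t = pgf z t" if "0 \<le> t" for z t
    using pgf[OF that] by (simp add: pgf_def)
  show ?thesis
    unfolding p_def[symmetric] using pgf eq pgf_eq_explicit_solution pgf_solves_problem
      solves_problem_cong[OF pgf_solves_problem, of "level_pgf M X"]
      solves_problem_cong[OF pgf_solves_problem, of "explicit_solution N lam \<mu> \<xi> (p 0)"]
    by auto
qed

end
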